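(* Let $\mathcal{Z}$ be a compact metric space and let $\mathcal{H}$ be a universal RKHS on $\mathcal{Z}$ with kernel $k$. Let $X_1,\dots,X_n\in\mathcal{Z}$ be such that the Gram matrix $K_{11}=(k(X_i,X_{i'}))_{i,i'=1}^n$ is non-singular, and let $\lambda>0$. For a twice continuously differentiable convex function $\psi:\mathbb{R}\to\mathbb{R}$ and $w\in\mathcal{H}$ let $D_{\psi,w}=\mathrm{diag}(\psi''(w(X_1)),\dots,\psi''(w(X_n)))$, and for a diagonal matrix $D\in\mathbb{R}^{n\times n}$ with non-negative entries let $$\kappa_0(D)=\kappa\Big(\frac1nK_{11}DK_{11}+\lambda K_{11}\Big).$$ Then $$\inf_{\psi:\,\psi''(1)=1}\ \sup_{w\in\mathcal{H}}\kappa_0(D_{\psi,w})=\kappa_0(I_n),$$ where the infimum is taken over all convex, twice continuously differentiable functions $\psi$ with $\psi''(1)=1$.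
   Context: For a symmetric positive definite matrix $A$, $\kappa(A)=\lambda_{\max}(A)/\lambda_{\min}(A)$. $I_n$ is the $n\times n$ identity matrix. A continuous kernel $k$ on a compact metric space $\mathcal{Z}$ is called universal if its RKHS $\mathcal{H}$ is dense in the continuous functions on $\mathcal{Z}$, i.e. for every continuous $g$ and $\varepsilon>0$ there is $f\in\mathcal{H}$ with $\|f-g\|_\infty<\varepsilon$; then $\mathcal{H}$ is called a universal RKHS. *)

theory Defs
  imports "HOL-Analysis.Analysis" "Jordan_Normal_Form.Spectral_Radius"
begin

text \<open>
  A real Hilbert space \<open>H\<close> of functions, with inner product \<open>ip\<close> (relevant on \<open>H\<close> only), whose
  point evaluations are represented by the kernel \<open>k\<close>. The vector space operations are pointwise.
\<close>
locale rkhs =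
  fixes H :: "('z \<Rightarrow> real) set"
    and ip :: "('z \<Rightarrow> real) \<Rightarrow> ('z \<Rightarrow> real) \<Rightarrow> real"
    and k :: "'z \<Rightarrow> 'z \<Rightarrow> real"
  assumes zero_mem: "(\<lambda>x. 0) \<in> H"
    and add_mem: "f \<in> H \<Longrightarrow> g \<in> H \<Longrightarrow> (\<lambda>x. f x + g x) \<in> H"
    and scale_mem: "f \<in> H \<Longrightarrow> (\<lambda>x. c * f x) \<in> H"
    and ip_commute: "f \<in> H \<Longrightarrow> g \<in> H \<Longrightarrow> ip f g = ip g f"
    and ip_add_left: "f \<in> H \<Longrightarrow> g \<in> H \<Longrightarrow> h \<in> H \<Longrightarrow> ip (\<lambda>x. f x + g x) h = ip f h + ip g h"
    and ip_scale_left: "f \<in> H \<Longrightarrow> g \<in> H \<Longrightarrow> ip (\<lambda>x. c * f x) g = c * ip f g"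
    and ip_nonneg: "f \<in> H \<Longrightarrow> 0 \<le> ip f f"
    and ip_eq_0: "f \<in> H \<Longrightarrow> ip f f = 0 \<Longrightarrow> f = (\<lambda>x. 0)"
    and complete:
      "(\<And>i. F i \<in> H) \<Longrightarrow>
       \<forall>e>0. \<exists>N. \<forall>i\<ge>N. \<forall>j\<ge>N. sqrt (ip (\<lambda>x. F i x - F j x) (\<lambda>x. F i x - F j x)) < e \<Longrightarrow>
       \<exists>f\<in>H. (\<lambda>i. sqrt (ip (\<lambda>x. F i x - f x) (\<lambda>x. F i x - f x))) \<longlonglongrightarrow> 0"
    and kernel_mem: "(\<lambda>y. k y x) \<in> H"
    and reproducing: "f \<in> H \<Longrightarrow> ip f (\<lambda>y. k y x) = f x"

text \<open>
  On a compact space every continuous function is bounded, so the type of bounded continuous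
  functions is \<open>C(Z)\<close>, and its norm is the supremum norm.
\<close>
locale universal_rkhs = rkhs H ip k
  for H :: "('z::metric_space \<Rightarrow> real) set" and ip k +
  assumes compact_domain: "compact (UNIV :: 'z set)"
    and continuous_kernel: "continuous_on UNIV (\<lambda>(x, y). k x y)"
    and dense: "\<forall>g :: 'z \<Rightarrow>\<^sub>C real. \<forall>e>0. \<exists>f. apply_bcontfun f \<in> H \<and> norm (f - g) < e"

definition twice_cont_diff :: "(real \<Rightarrow> real) \<Rightarrow> bool" where
  "twice_cont_diff \<psi> \<longleftrightarrow>
     (\<forall>x. \<psi> differentiable (at x)) \<and> (\<forall>x. deriv \<psi> differentiable (at x)) \<and>
     continuous_on UNIV (deriv (deriv \<psi>))"

text \<open>
  Condition number of a symmetric positive definite matrix of positive dimension: its spectrum is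
  then a finite nonempty set of positive reals. Not meaningful for other matrices.
\<close>
definition cond_num :: "real mat \<Rightarrow> real" where
  "cond_num A = Max (spectrum A) / Min (spectrum A)"

definition gram_mat :: "('z \<Rightarrow> 'z \<Rightarrow> real) \<Rightarrow> nat \<Rightarrow> (nat \<Rightarrow> 'z) \<Rightarrow> real mat" where
  "gram_mat k n X = Matrix.mat n n (\<lambda>(i, j). k (X i) (X j))"

definition kappa0 :: "real mat \<Rightarrow> real \<Rightarrow> real mat \<Rightarrow> real" where
  "kappa0 K lam D = cond_num ((1 / real (dim_row K)) \<cdot>\<^sub>m (K * D * K) + lam \<cdot>\<^sub>m K)"

definition D_mat :: "nat \<Rightarrow> (nat \<Rightarrow> 'z) \<Rightarrow> (real \<Rightarrow> real) \<Rightarrow> ('z \<Rightarrow> real) \<Rightarrow> real mat" where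
  "D_mat n X \<psi> w = mat_diag n (\<lambda>i. deriv (deriv \<psi>) (w (X i)))"

end

theory Submission
  imports Defs
begin

text \<open>
  The choice \<open>\<psi> x = x\<^sup>2 / 2\<close> has \<open>D_mat n X \<psi> w = 1\<^sub>m n\<close> for every \<open>w\<close>. Conversely, invertibility of the
  Gram matrix lets some \<open>w\<close> in the span of the kernel sections interpolate the value \<open>1\<close> at all the
  points, so the supremum for any admissible \<open>\<psi>\<close> includes the value at the identity matrix.
\<close>

context rkhs
begin

lemma kernel_sum_mem: "(\<lambda>y. \<Sum>j<(m::nat). c j * k y (X j)) \<in> H"
proof (induction m)
  case 0
  show ?case using zero_mem by simp
next
  case (Suc m)
  show ?case using add_mem[OF Suc scale_mem[OF kernel_mem]] by simp
qed

text \<open>For a combination of the kernel sections at the points, prescribing the values there is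
  a linear system in the coefficients whose matrix is \<open>gram_mat k n X\<close>, and
  invertibility solves it for every right-hand side.\<close>

lemma interpolation:
  fixes v :: "nat \<Rightarrow> real"
  assumes "invertible_mat (gram_mat k n X)"
  obtains w where "w \<in> H" "\<And>i. i < n \<Longrightarrow> w (X i) = v i"
proof -
  let ?K = "gram_mat k n X"
  have K: "?K \<in> carrier_mat n n" by (simp add: gram_mat_def)
  obtain B where KB: "?K * B = 1\<^sub>m n" and BK: "B * ?K = 1\<^sub>m (dim_row B)"
    using assms K by (auto simp: invertible_mat_def inverts_mat_def)
  \<comment> \<open>Invertibility does not state the shape of \<open>B\<close>; counting columns on
    both sides of \<open>KB\<close> and \<open>BK\<close> forces it to be square of size
    \<open>n\<close>.\<close>
  have "dim_col B = n" using arg_cong[OF KB, of dim_col] by simp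
  moreover have "dim_row B = n" using arg_cong[OF BK, of dim_col] K by simp
  ultimately have B: "B \<in> carrier_mat n n" by auto
  define u where "u = Matrix.vec n v"
  define c where "c = B *\<^sub>v u"
  have u: "u \<in> carrier_vec n" by (simp add: u_def)
  have c: "c \<in> carrier_vec n" using B u by (auto simp: c_def)
  have Kc: "?K *\<^sub>v c = u"
    unfolding c_def using assoc_mult_mat_vec[OF K B u] KB u by simp
  let ?w = "\<lambda>y. \<Sum>j<n. vec_index c j * k y (X j)"
  \<comment> \<open>Evaluating \<open>?w\<close> at \<open>X i\<close> pairs row \<open>i\<close> of
    \<open>?K\<close> with \<open>c\<close>, because the sections fix the second argument of
    \<open>k\<close>.\<close>
  have "?w (X i) = v i" if "i < n" for i
  proof -
    have "v i = vec_index (?K *\<^sub>v c) i" using that Kc by (simp add: u_def)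
    also have "\<dots> = (\<Sum>j<n. k (X i) (X j) * vec_index c j)"
      using that c by (simp add: gram_mat_def scalar_prod_def atLeast0LessThan)
    finally show ?thesis by (simp add: mult.commute)
  qed
  then show thesis using that kernel_sum_mem by blast
qed

end

lemma deriv_half_square: "deriv (\<lambda>x::real. x\<^sup>2 / 2) = (\<lambda>x. x)"
  by (rule ext, rule DERIV_imp_deriv) (auto intro!: derivative_eq_intros)

lemma deriv_deriv_half_square: "deriv (deriv (\<lambda>x::real. x\<^sup>2 / 2)) = (\<lambda>x. 1)"
  unfolding deriv_half_square by (rule ext, rule DERIV_imp_deriv) (auto intro!: derivative_eq_intros)

lemma twice_cont_diff_half_square: "twice_cont_diff (\<lambda>x. x\<^sup>2 / 2)"
  unfolding twice_cont_diff_def deriv_deriv_half_square unfolding deriv_half_square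
  by (auto intro!: derivative_intros)

lemma convex_half_square: "convex_on UNIV (\<lambda>x::real. x\<^sup>2 / 2)"
  by (rule f''_ge0_imp_convex[where f' = "\<lambda>x. x" and f'' = "\<lambda>x. 1"])
    (auto intro!: derivative_eq_intros)

text \<open>Serves both inequalities: the hypothesis holds if \<psi>'' is constantly 1, and also if
  \<psi>'' is 1 only at 1 but \<open>w\<close> equals 1 at all the points.\<close>

lemma D_mat_eq_one:
  assumes "\<And>i. i < n \<Longrightarrow> deriv (deriv \<psi>) (w (X i)) = 1"
  shows "D_mat n X \<psi> w = 1\<^sub>m n"
  using assms by (intro eq_matI) (auto simp: D_mat_def mat_diag_def)

theorem theorem4:
  fixes H :: "('z::metric_space \<Rightarrow> real) set"
    and ip :: "('z \<Rightarrow> real) \<Rightarrow> ('z \<Rightarrow> real) \<Rightarrow> real"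
    and k :: "'z \<Rightarrow> 'z \<Rightarrow> real"
    and n :: nat and X :: "nat \<Rightarrow> 'z" and lam :: real
  assumes "universal_rkhs H ip k"
    and "n > 0"
    and "invertible_mat (gram_mat k n X)"
    and "lam > 0"
  shows "(INF \<psi> \<in> {\<psi>. convex_on UNIV \<psi> \<and> twice_cont_diff \<psi> \<and> deriv (deriv \<psi>) 1 = 1}.
            SUP w \<in> H. ereal (kappa0 (gram_mat k n X) lam (D_mat n X \<psi> w)))
         = ereal (kappa0 (gram_mat k n X) lam (1\<^sub>m n))"
proof -
  interpret universal_rkhs H ip k by fact
  let ?A = "{\<psi>. convex_on UNIV \<psi> \<and> twice_cont_diff \<psi> \<and> deriv (deriv \<psi>) 1 = 1}"
  let ?\<kappa> = "\<lambda>D. ereal (kappa0 (gram_mat k n X) lam D)"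
  show ?thesis
  proof (rule antisym)
    let ?q = "\<lambda>x::real. x\<^sup>2 / 2"
    have "?q \<in> ?A"
      by (simp add: convex_half_square twice_cont_diff_half_square deriv_deriv_half_square)
    moreover have "(SUP w \<in> H. ?\<kappa> (D_mat n X ?q w)) \<le> ?\<kappa> (1\<^sub>m n)"
      by (rule SUP_least) (simp add: D_mat_eq_one deriv_deriv_half_square)
    ultimately show "(INF \<psi> \<in> ?A. SUP w \<in> H. ?\<kappa> (D_mat n X \<psi> w)) \<le> ?\<kappa> (1\<^sub>m n)"
      by (intro INF_lower2[where i = ?q])
  next
    \<comment> \<open>The target value 1 is the one argument at which the normalisation fixes
      \<psi>''. This \<open>w\<close> is chosen before \<psi>, so a single function bounds all the
      suprema from below.\<close>
    obtain w where w: "w \<in> H" "\<And>i. i < n \<Longrightarrow> w (X i) = 1"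
      using interpolation[OF assms(3), where v = "\<lambda>_. 1"] by blast
    show "?\<kappa> (1\<^sub>m n) \<le> (INF \<psi> \<in> ?A. SUP w \<in> H. ?\<kappa> (D_mat n X \<psi> w))"
    proof (rule INF_greatest)
      fix \<psi> assume "\<psi> \<in> ?A"
      then have "D_mat n X \<psi> w = 1\<^sub>m n" using w by (intro D_mat_eq_one) simp
      then show "?\<kappa> (1\<^sub>m n) \<le> (SUP w \<in> H. ?\<kappa> (D_mat n X \<psi> w))"
        using w(1) by (intro SUP_upper2) auto
    qed
  qed
qed

end
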